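(* Consider the optimization problem over Hermitian matrices $X,Z_+,Z_-\in\mathbb{C}^{n\times n}$ $$\begin{array}{cl}\underset{X,\,Z_+,\,Z_-}{\text{minimize}} & -\log\det X+\gamma\left(\operatorname{trace}(Z_+)+\operatorname{trace}(Z_-)\right)\\ \text{subject to} & \mathcal{A}_1(X)+Z_+-Z_-=0,\\ & \mathcal{A}_2(X)-G=0,\\ & Z_+\succeq 0,\quad Z_-\succeq 0.\end{array}$$ The Lagrange dual of this problem is $$\begin{array}{cl}\underset{Y_1,\,Y_2}{\text{maximize}} & \log\det\left(\mathcal{A}_1^\dagger(Y_1)+\mathcal{A}_2^\dagger(Y_2)\right)-\langle G,Y_2\rangle+n\\ \text{subject to} & \|Y_1\|_2\le\gamma,\end{array}$$ where the Hermitian matrices $Y_1\in\mathbb{C}^{n\times n}$ and $Y_2\in\mathbb{C}^{p\times p}$ are the dual variables associated with the equality constraints $\mathcal{A}_1(X)+Z_+-Z_-=0$ and $\mathcal{A}_2(X)-G=0$, respectively.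
   Context: Data: $A\in\mathbb{C}^{n\times n}$ Hurwitz, $C\in\mathbb{C}^{p\times n}$, a Hermitian matrix $G\in\mathbb{C}^{p\times p}$ whose entries are partially available, the symmetric 0/1 matrix $E$ with $E_{ij}=1$ if $G_{ij}$ is available and $E_{ij}=0$ otherwise (unavailable entries of $G$ are set to zero), and $\gamma>0$. $\circ$ is elementwise multiplication of matrices. The linear operators are $$\mathcal{A}_1(X)=AX+XA^*,\qquad \mathcal{A}_2(X)=(CXC^* )\circ E,$$ with adjoints, with respect to $\langle M_1,M_2\rangle=\operatorname{trace}(M_1^*M_2)$, $$\mathcal{A}_1^\dagger(Y)=A^*Y+YA,\qquad \mathcal{A}_2^\dagger(Y)=C^*(E\circ Y)C.$$ $\|\cdot\|_2$ is the spectral norm (largest singular value). $\log\det$ has as its domain the positive definite matrices (so $-\log\det X=+\infty$ if $X\not\succ0$). The Lagrangian is $$\mathcal{L}=-\log\det X+\gamma\operatorname{trace}(Z_++Z_-)-\langle\Lambda_+,Z_+\rangle-\langle\Lambda_-,Z_-\rangle+\langle Y_1,\mathcal{A}_1(X)+Z_+-Z_-\rangle+\langle Y_2,\mathcal{A}_2(X)-G\rangle$$ with Hermitian $Y_1,Y_2$ and multipliers $\Lambda_\pm\succeq0$ for the inequality constraints; the multipliers $\Lambda_\pm$ are eliminated from the dual problem. *)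

theory Defs
  imports "HOL-Analysis.Analysis"
begin

section \<open>Complex matrices\<close>

definition ctranspose :: "complex^'n^'m \<Rightarrow> complex^'m^'n"
  where "ctranspose M = (\<chi> i j. cnj (M $ j $ i))"

definition hermitian :: "complex^'n^'n \<Rightarrow> bool"
  where "hermitian M \<longleftrightarrow> ctranspose M = M"

text \<open>
  On \<open>complex^'n\<close> the library's \<open>x \<bullet> y\<close> is the real inner product, i.e. the real part of
  \<open>x\<^sup>* y\<close>; for Hermitian \<open>M\<close> the number \<open>x\<^sup>* M x\<close> is real, so it equals \<open>x \<bullet> (M *v x)\<close>.
\<close>

definition pos_semidef :: "complex^'n^'n \<Rightarrow> bool"
  where "pos_semidef M \<longleftrightarrow> hermitian M \<and> (\<forall>x. 0 \<le> x \<bullet> (M *v x))"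

definition pos_def :: "complex^'n^'n \<Rightarrow> bool"
  where "pos_def M \<longleftrightarrow> hermitian M \<and> (\<forall>x. x \<noteq> 0 \<longrightarrow> 0 < x \<bullet> (M *v x))"

definition hurwitz :: "complex^'n^'n \<Rightarrow> bool"
  where "hurwitz M \<longleftrightarrow> (\<forall>c v. v \<noteq> 0 \<and> M *v v = c *s v \<longrightarrow> Re c < 0)"

definition singular_values :: "complex^'n^'n \<Rightarrow> real set"
  where "singular_values M =
    {s. 0 \<le> s \<and> (\<exists>v. v \<noteq> 0 \<and> (ctranspose M ** M) *v v = complex_of_real (s\<^sup>2) *s v)}"

definition spectral_norm :: "complex^'n^'n \<Rightarrow> real"
  where "spectral_norm M = Max (singular_values M)"

definition hadamard :: "complex^'n^'m \<Rightarrow> complex^'n^'m \<Rightarrow> complex^'n^'m"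
  where "hadamard M N = (\<chi> i j. M $ i $ j * N $ i $ j)"

definition mat_inner :: "complex^'n^'n \<Rightarrow> complex^'n^'n \<Rightarrow> complex"
  where "mat_inner M N = trace (ctranspose M ** N)"

text \<open>
  The determinant of a positive definite matrix is a positive real number, so taking its real
  part loses nothing.
\<close>

definition log_det :: "complex^'n^'n \<Rightarrow> ereal"
  where "log_det M = (if pos_def M then ereal (ln (Re (det M))) else - \<infinity>)"


section \<open>The linear operators\<close>

definition A1 :: "complex^'n^'n \<Rightarrow> complex^'n^'n \<Rightarrow> complex^'n^'n"
  where "A1 A X = A ** X + X ** ctranspose A"

definition A2 :: "complex^'n^'p \<Rightarrow> complex^'p^'p \<Rightarrow> complex^'n^'n \<Rightarrow> complex^'p^'p"
  where "A2 C E X = hadamard (C ** X ** ctranspose C) E"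

definition A1_adj :: "complex^'n^'n \<Rightarrow> complex^'n^'n \<Rightarrow> complex^'n^'n"
  where "A1_adj A Y = ctranspose A ** Y + Y ** A"

definition A2_adj :: "complex^'n^'p \<Rightarrow> complex^'p^'p \<Rightarrow> complex^'p^'p \<Rightarrow> complex^'n^'n"
  where "A2_adj C E Y = ctranspose C ** hadamard E Y ** C"


section \<open>The optimization problem and its Lagrange dual\<close>

text \<open>
  The primal problem is: over Hermitian \<open>X\<close>, \<open>Zp\<close>, \<open>Zm\<close>, minimize \<open>primal_objective \<gamma> X Zp Zm\<close>
  subject to \<open>residual1 A X Zp Zm = 0\<close>, \<open>residual2 C E G X = 0\<close>, \<open>pos_semidef Zp\<close> and
  \<open>pos_semidef Zm\<close>. The traces and inner products below are of Hermitian matrices, hence real;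
  \<open>Re\<close> is only a change of type. Apart from the objective all terms are finite, so the sums in
  \<open>ereal\<close> are never of the form \<open>\<infinity> - \<infinity>\<close>.
\<close>

definition primal_objective ::
    "real \<Rightarrow> complex^'n^'n \<Rightarrow> complex^'n^'n \<Rightarrow> complex^'n^'n \<Rightarrow> ereal"
  where "primal_objective \<gamma> X Zp Zm = - log_det X + ereal (\<gamma> * Re (trace Zp + trace Zm))"

definition residual1 ::
    "complex^'n^'n \<Rightarrow> complex^'n^'n \<Rightarrow> complex^'n^'n \<Rightarrow> complex^'n^'n \<Rightarrow> complex^'n^'n"
  where "residual1 A X Zp Zm = A1 A X + Zp - Zm"

definition residual2 ::
    "complex^'n^'p \<Rightarrow> complex^'p^'p \<Rightarrow> complex^'p^'p \<Rightarrow> complex^'n^'n \<Rightarrow> complex^'p^'p"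
  where "residual2 C E G X = A2 C E X - G"

definition lagrangian ::
    "complex^'n^'n \<Rightarrow> complex^'n^'p \<Rightarrow> complex^'p^'p \<Rightarrow> complex^'p^'p \<Rightarrow> real \<Rightarrow>
     complex^'n^'n \<Rightarrow> complex^'n^'n \<Rightarrow> complex^'n^'n \<Rightarrow>
     complex^'n^'n \<Rightarrow> complex^'p^'p \<Rightarrow> complex^'n^'n \<Rightarrow> complex^'n^'n \<Rightarrow> ereal"
  where "lagrangian A C E G \<gamma> X Zp Zm Y1 Y2 Lp Lm =
    primal_objective \<gamma> X Zp Zm
    + ereal (- Re (mat_inner Lp Zp) - Re (mat_inner Lm Zm)
             + Re (mat_inner Y1 (residual1 A X Zp Zm))
             + Re (mat_inner Y2 (residual2 C E G X)))"

definition dual_function ::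
    "complex^'n^'n \<Rightarrow> complex^'n^'p \<Rightarrow> complex^'p^'p \<Rightarrow> complex^'p^'p \<Rightarrow> real \<Rightarrow>
     complex^'n^'n \<Rightarrow> complex^'p^'p \<Rightarrow> complex^'n^'n \<Rightarrow> complex^'n^'n \<Rightarrow> ereal"
  where "dual_function A C E G \<gamma> Y1 Y2 Lp Lm =
    (INF (X, Zp, Zm) \<in> {X. hermitian X} \<times> {Z. hermitian Z} \<times> {Z. hermitian Z}.
       lagrangian A C E G \<gamma> X Zp Zm Y1 Y2 Lp Lm)"

text \<open>
  The Lagrange dual problem maximizes \<open>dual_function\<close> over Hermitian \<open>Y1\<close>, \<open>Y2\<close> and positive
  semidefinite \<open>Lp\<close>, \<open>Lm\<close>. Eliminating \<open>Lp\<close> and \<open>Lm\<close> means performing the maximization over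
  them first. As usual, points where the resulting objective is \<open>-\<infinity>\<close> are the infeasible ones.
\<close>

definition lagrange_dual ::
    "complex^'n^'n \<Rightarrow> complex^'n^'p \<Rightarrow> complex^'p^'p \<Rightarrow> complex^'p^'p \<Rightarrow> real \<Rightarrow>
     complex^'n^'n \<Rightarrow> complex^'p^'p \<Rightarrow> ereal"
  where "lagrange_dual A C E G \<gamma> Y1 Y2 =
    (SUP (Lp, Lm) \<in> {L. pos_semidef L} \<times> {L. pos_semidef L}. dual_function A C E G \<gamma> Y1 Y2 Lp Lm)"

definition dual_objective ::
    "complex^'n^'n \<Rightarrow> complex^'n^'p \<Rightarrow> complex^'p^'p \<Rightarrow> complex^'p^'p \<Rightarrow>
     complex^'n^'n \<Rightarrow> complex^'p^'p \<Rightarrow> ereal"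
  where "dual_objective A C E G Y1 Y2 =
    log_det (A1_adj A Y1 + A2_adj C E Y2) - ereal (Re (mat_inner G Y2)) + ereal (real CARD('n))"

end

theory Submission
  imports Defs
begin

text \<open>
  Moving the operators to the other side of the inner products collects the Lagrangian by primal
  variable: with the Hermitian matrix \<open>M = A1_adj A Y1 + A2_adj C E Y2\<close> it is
  \<open>(- log det X + trace (M X)) + \<langle>\<gamma> I + Y1 - Lp, Zp\<rangle> + \<langle>\<gamma> I - Y1 - Lm, Zm\<rangle> - \<langle>G, Y2\<rangle>\<close>
  (\<open>lagrangian_collected\<close>).
  
  The two middle terms are linear in the free Hermitian variables \<open>Zp\<close> and \<open>Zm\<close>, so their
  infimum is \<open>-\<infinity>\<close> unless both coefficients vanish, that is, unless \<open>Lp = \<gamma> I + Y1\<close> and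
  \<open>Lm = \<gamma> I - Y1\<close>. Thus at most one pair of multipliers contributes to the maximization over
  \<open>Lp\<close> and \<open>Lm\<close>, and it is admissible exactly if \<open>-\<gamma> I \<preceq> Y1 \<preceq> \<gamma> I\<close>; for a Hermitian matrix
  this says that no eigenvalue exceeds \<open>\<gamma>\<close> in modulus, i.e. that the spectral norm is at most
  \<open>\<gamma>\<close> (\<open>spectral_norm_le_iff_pos_semidef\<close>).
  
  What remains is the infimum of \<open>- log det X + trace (M X)\<close> over \<open>X\<close>
  (\<open>Inf_neg_log_det_plus_linear\<close>). If \<open>M\<close> is positive definite, write \<open>M = Q Q\<^sup>*\<close>; the
  eigenvalues \<open>\<mu>\<close> of \<open>Q\<^sup>* X Q\<close> are positive, and summing \<open>ln \<mu> \<le> \<mu> - 1\<close> over them gives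
  \<open>log det M + log det X \<le> trace (M X) - n\<close>, with equality at \<open>X = M\<^sup>-\<^sup>1\<close>. So the infimum is
  \<open>log det M + n\<close>. If \<open>M\<close> has an eigenvalue \<open>\<le> 0\<close>, stretching \<open>X\<close> along an eigenvector of it
  lets \<open>log det X\<close> grow without bound while the trace stays bounded above, and the infimum
  is \<open>-\<infinity>\<close>.
  
  All statements about eigenvalues rest on the spectral theorem for Hermitian matrices
  (\<open>hermitian_unitarily_diagonalizable\<close>), obtained by maximizing the quadratic form on unit
  spheres of invariant subspaces.
\<close>

section \<open>The conjugate transpose\<close>

lemma ctranspose_nth [simp]: "ctranspose M $ i $ j = cnj (M $ j $ i)"
  by (simp add: ctranspose_def)

lemma ctranspose_ctranspose [simp]: "ctranspose (ctranspose M) = M"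
  by (simp add: vec_eq_iff)

lemma ctranspose_mat_1 [simp]: "ctranspose (mat 1) = mat 1"
  by (simp add: vec_eq_iff mat_def)

lemma ctranspose_add: "ctranspose (M + N) = ctranspose M + ctranspose N"
  by (simp add: vec_eq_iff)

lemma ctranspose_diff: "ctranspose (M - N) = ctranspose M - ctranspose N"
  by (simp add: vec_eq_iff)

lemma ctranspose_scaleR: "ctranspose (r *\<^sub>R M) = r *\<^sub>R ctranspose M"
  by (simp add: vec_eq_iff)

lemma ctranspose_mult: "ctranspose (M ** N) = ctranspose N ** ctranspose M"
  by (simp add: vec_eq_iff matrix_matrix_mult_def mult.commute)

text \<open>
  The inner product here is only the real part of the Hermitian one, but \<open>Re (cnj (cnj m a) b)\<close>
  and \<open>Re (cnj a (m b))\<close> agree, so the conjugate transpose is the adjoint for it as well.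
\<close>

lemma inner_ctranspose_mult_vector: "(ctranspose M *v x) \<bullet> y = x \<bullet> (M *v y)"
proof -
  have "(cnj m * a) \<bullet> b = a \<bullet> (m * b)" for m a b :: complex
    by (simp add: inner_complex_def algebra_simps)
  then have "(ctranspose M *v x) \<bullet> y = (\<Sum>j\<in>UNIV. \<Sum>i\<in>UNIV. x $ i \<bullet> (M $ i $ j * y $ j))"
    by (simp add: inner_vec_def matrix_vector_mult_def inner_sum_left)
  also have "\<dots> = x \<bullet> (M *v y)"
    by (subst sum.swap) (simp add: inner_vec_def matrix_vector_mult_def inner_sum_right)
  finally show ?thesis .
qed

lemma complex_matrix_vector_mult_scaleR:
  fixes M :: "complex^'n^'m"
  shows "M *v (r *\<^sub>R x) = r *\<^sub>R (M *v x)"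
  by (simp add: vec_eq_iff matrix_vector_mult_def scaleR_sum_right)

lemma hermitian_inner: "hermitian M \<Longrightarrow> (M *v x) \<bullet> y = x \<bullet> (M *v y)"
  by (metis hermitian_def inner_ctranspose_mult_vector)

lemma hermitian_add: "hermitian M \<Longrightarrow> hermitian N \<Longrightarrow> hermitian (M + N)"
  by (simp add: hermitian_def ctranspose_add)

lemma hermitian_diff: "hermitian M \<Longrightarrow> hermitian N \<Longrightarrow> hermitian (M - N)"
  by (simp add: hermitian_def ctranspose_diff)

lemma hermitian_scaleR: "hermitian M \<Longrightarrow> hermitian (r *\<^sub>R M)"
  by (simp add: hermitian_def ctranspose_scaleR)

lemma hermitian_mat_1: "hermitian (mat 1)"
  by (simp add: hermitian_def)

lemma hermitian_congruence: "hermitian M \<Longrightarrow> hermitian (ctranspose P ** M ** P)"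
  by (simp add: hermitian_def ctranspose_mult matrix_mul_assoc)


section \<open>The spectral theorem\<close>

text \<open>
  A maximizer of the quadratic form \<open>x \<bullet> (M *v x)\<close> on the unit sphere of \<open>W\<close> is an eigenvector:
  by the first-order condition \<open>M *v v\<close> is orthogonal to every vector of \<open>W\<close> orthogonal to \<open>v\<close>,
  hence to its own component orthogonal to \<open>v\<close>. Only the symmetry of \<open>M\<close> for the
  real inner product enters, so a real subspace \<open>W\<close> suffices and the eigenvalue comes out real.
\<close>

lemma hermitian_eigenvector_in_invariant_subspace:
  fixes M :: "complex^'n^'n"
  assumes herm: "hermitian M" and sub: "subspace W" and inv: "\<And>x. x \<in> W \<Longrightarrow> M *v x \<in> W"
    and ne: "x0 \<in> W" "x0 \<noteq> 0"
  obtains v d where "v \<in> W" "norm v = 1" "M *v v = d *\<^sub>R v"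
proof -
  let ?S = "sphere 0 1 \<inter> W"
  have "x0 /\<^sub>R norm x0 \<in> ?S"
    using ne sub by (simp add: subspace_scale)
  then have "?S \<noteq> {}" by blast
  moreover have "compact ?S"
    by (intro compact_Int_closed closed_subspace sub) auto
  moreover have "continuous_on ?S (\<lambda>x. x \<bullet> (M *v x))"
    by (intro continuous_intros linear_continuous_on linear_conv_bounded_linear[THEN iffD1] linearI)
      (simp_all add: matrix_vector_right_distrib complex_matrix_vector_mult_scaleR)
  ultimately obtain v where v: "v \<in> ?S" and max: "\<And>x. x \<in> ?S \<Longrightarrow> x \<bullet> (M *v x) \<le> v \<bullet> (M *v v)"
    using continuous_attains_sup[of ?S "\<lambda>x. x \<bullet> (M *v x)"] by blast
  then have vW: "v \<in> W" and nv: "norm v = 1" by auto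
  define d where "d = v \<bullet> (M *v v)"
  have quad: "x \<bullet> (M *v x) \<le> d * (x \<bullet> x)" if "x \<in> W" for x
  proof (cases "x = 0")
    case False
    have "x /\<^sub>R norm x \<in> ?S"
      using False that sub by (simp add: subspace_scale)
    from max[OF this] have "(x \<bullet> (M *v x)) / (norm x * norm x) \<le> d"
      by (simp add: d_def complex_matrix_vector_mult_scaleR divide_inverse mult_ac)
    then show ?thesis
      using False by (simp add: pos_divide_le_eq flip: power2_eq_square power2_norm_eq_inner)
  qed simp
  have orth: "w \<bullet> (M *v v) = 0" if w: "w \<in> W" "w \<bullet> v = 0" for w
  proof -
    define a where "a = w \<bullet> (M *v v)"
    define k where "k = d * (w \<bullet> w) - w \<bullet> (M *v w)"
    have cross: "v \<bullet> (M *v w) = a"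
      unfolding a_def using hermitian_inner[OF herm, of v w] by (metis inner_commute)
    have vw: "v \<bullet> w = 0" using w(2) by (simp add: inner_commute)
    have t: "2 * t * a \<le> t\<^sup>2 * k" for t :: real
    proof -
      have "v + t *\<^sub>R w \<in> W" by (intro subspace_add subspace_scale sub vW w)
      from quad[OF this] have "d + 2 * t * a + t\<^sup>2 * (w \<bullet> (M *v w)) \<le> d * (1 + t\<^sup>2 * (w \<bullet> w))"
        using w(2) nv cross vw
        by (simp add: matrix_vector_right_distrib complex_matrix_vector_mult_scaleR inner_add_left inner_add_right
            d_def[symmetric] a_def[symmetric] power2_eq_square norm_eq_1 distrib_left mult_ac)
      then show ?thesis by (simp add: k_def algebra_simps)
    qed
    \<comment> \<open>For small \<open>t\<close> of the sign of \<open>a\<close> the linear term would win, so it has to vanish.\<close>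
    define t where "t = a / (\<bar>k\<bar> + 1)"
    have "t\<^sup>2 * k \<le> t\<^sup>2 * (\<bar>k\<bar> + 1)" by (intro mult_left_mono) auto
    also have "\<dots> = t * a" by (simp add: t_def power2_eq_square)
    finally have "t * a \<le> 0" using t[of t] by simp
    moreover have "\<bar>k\<bar> + 1 > 0" by simp
    ultimately have "a * a \<le> 0" by (simp add: t_def divide_le_0_iff)
    then have "a = 0" by (metis mult_eq_0_iff order_antisym zero_le_square)
    then show ?thesis by (simp add: a_def)
  qed
  \<comment> \<open>The component of \<open>M *v v\<close> orthogonal to \<open>v\<close>.\<close>
  define z where "z = M *v v - d *\<^sub>R v"
  have zW: "z \<in> W" unfolding z_def by (intro subspace_diff subspace_scale sub vW inv)
  have zv: "z \<bullet> v = 0" using nv by (simp add: z_def inner_diff_left d_def inner_commute[of v "M *v v"] norm_eq_1)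
  have "z \<bullet> z = z \<bullet> (M *v v) - d * (z \<bullet> v)" by (simp add: z_def inner_diff_right inner_diff_left)
  then have "z \<bullet> z = 0" using orth[OF zW zv] zv by simp
  then have "M *v v = d *\<^sub>R v" by (simp add: z_def)
  with vW nv that show ?thesis by blast
qed

text \<open>
  The Hermitian product of \<open>u i\<close> and \<open>u j\<close> has real part \<open>u i \<bullet> u j\<close> and, up to sign, imaginary
  part \<open>u i \<bullet> (\<i> *s u j)\<close>. Orthonormality over the complex numbers is stated through both parts.
  In the induction the next eigenvector is found in the real orthogonal complement of all \<open>u i\<close>
  and all \<open>\<i> *s u i\<close>, which is nonzero because fewer than \<open>2 * CARD('n)\<close> vectors are removed from a
  space of that real dimension, and which is invariant because the eigenvalues are real.
\<close>

lemma orthonormal_eigenvectors_exist: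
  fixes M :: "complex^'n^'n" and S :: "'n set"
  assumes herm: "hermitian M"
  shows "\<exists>u (d :: 'n \<Rightarrow> real).
    (\<forall>i\<in>S. M *v u i = d i *\<^sub>R u i) \<and>
    (\<forall>i\<in>S. \<forall>j\<in>S. u i \<bullet> u j = (if i = j then 1 else 0) \<and> u i \<bullet> (\<i> *s u j) = 0)"
  using finite[of S]
proof (induction S rule: finite_induct)
  case empty
  show ?case by simp
next
  case (insert k S)
  then obtain u :: "'n \<Rightarrow> complex^'n" and d :: "'n \<Rightarrow> real" where
    eig: "\<And>i. i \<in> S \<Longrightarrow> M *v u i = d i *\<^sub>R u i" and
    on: "\<And>i j. i \<in> S \<Longrightarrow> j \<in> S \<Longrightarrow> u i \<bullet> u j = (if i = j then 1 else 0) \<and> u i \<bullet> (\<i> *s u j) = 0"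
    by blast
  define B where "B = u ` S \<union> (\<lambda>i. \<i> *s u i) ` S"
  define W where "W = {x. \<forall>b\<in>B. orthogonal b x}"
  have sub: "subspace W" unfolding W_def by (rule subspace_orthogonal_to_vectors)
  have inv: "M *v x \<in> W" if "x \<in> W" for x
  proof -
    have "M *v (\<i> *s u i) = d i *\<^sub>R (\<i> *s u i)" if "i \<in> S" for i
      using eig[OF that] by (simp add: vector_scalar_commute vec_eq_iff)
    then show ?thesis
      using \<open>x \<in> W\<close> eig hermitian_inner[OF herm, symmetric]
      by (auto simp: W_def B_def orthogonal_def)
  qed
  have "card S < CARD('n)"
    using insert.hyps by (metis UNIV_I finite psubset_card_mono psubsetI subset_UNIV)
  moreover have "dim B \<le> 2 * card S"
  proof -
    have "dim B \<le> card B" by (intro dim_le_card') (simp add: B_def insert.hyps)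
    also have "\<dots> \<le> card (u ` S) + card ((\<lambda>i. \<i> *s u i) ` S)" unfolding B_def by (rule card_Un_le)
    also have "\<dots> \<le> 2 * card S" by (metis add_mono card_image_le insert.hyps(1) mult_2)
    finally show ?thesis .
  qed
  ultimately have dim: "dim B < DIM(complex^'n)" by simp
  obtain x0 where "x0 \<noteq> 0" "\<And>y. y \<in> span B \<Longrightarrow> orthogonal x0 y"
    using orthogonal_to_subspace_exists[OF dim] by metis
  then have "x0 \<in> W" "x0 \<noteq> 0" by (auto simp: W_def orthogonal_commute span_base)
  with hermitian_eigenvector_in_invariant_subspace[OF herm sub inv]
  obtain v c where v: "v \<in> W" "norm v = 1" "M *v v = c *\<^sub>R v" by blast
  have i_inner: "x \<bullet> (\<i> *s y) = - ((\<i> *s x) \<bullet> y)" for x y :: "complex^'n"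
    unfolding inner_vec_def sum_negf[symmetric]
    by (intro sum.cong) (auto simp: inner_complex_def)
  have vu: "u i \<bullet> v = 0" "v \<bullet> u i = 0" "v \<bullet> (\<i> *s u i) = 0" "u i \<bullet> (\<i> *s v) = 0" if "i \<in> S" for i
  proof -
    have *: "u i \<bullet> v = 0" "(\<i> *s u i) \<bullet> v = 0"
      using v(1) that by (simp_all add: W_def B_def orthogonal_def)
    then show "u i \<bullet> v = 0" "v \<bullet> u i = 0" "v \<bullet> (\<i> *s u i) = 0" "u i \<bullet> (\<i> *s v) = 0"
      by (simp_all add: i_inner[of "u i" v] inner_commute[of v])
  qed
  have "v \<bullet> v = 1" using v(2) by (simp add: norm_eq_1)
  moreover have "v \<bullet> (\<i> *s v) = 0"
    using i_inner[of v v] inner_commute[of v "\<i> *s v"] by linarith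
  ultimately have vv: "v \<bullet> v = 1" "v \<bullet> (\<i> *s v) = 0" by simp_all
  show ?case
  proof (intro exI conjI ballI)
    fix i j
    assume "i \<in> insert k S" "j \<in> insert k S"
    then show "(u(k := v)) i \<bullet> (u(k := v)) j = (if i = j then 1 else 0)"
      and "(u(k := v)) i \<bullet> (\<i> *s (u(k := v)) j) = 0"
      using vu vv on insert.hyps(2) by auto
  next
    fix i
    assume "i \<in> insert k S"
    then show "M *v (u(k := v)) i = (d(k := c)) i *\<^sub>R (u(k := v)) i"
      using eig v(3) by auto
  qed
qed

definition diag_mat :: "('n \<Rightarrow> real) \<Rightarrow> complex^'n^'n"
  where "diag_mat d = (\<chi> i j. if i = j then complex_of_real (d i) else 0)"

lemma mult_diag_mat_nth: "(M ** diag_mat d) $ i $ j = complex_of_real (d j) * M $ i $ j"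
proof -
  have "M $ i $ k * diag_mat d $ k $ j = (if k = j then complex_of_real (d j) * M $ i $ j else 0)" for k
    by (simp add: diag_mat_def)
  then show ?thesis by (simp add: matrix_matrix_mult_def)
qed

definition unitary :: "complex^'n^'n \<Rightarrow> bool"
  where "unitary U \<longleftrightarrow> ctranspose U ** U = mat 1 \<and> U ** ctranspose U = mat 1"

theorem hermitian_unitarily_diagonalizable:
  fixes M :: "complex^'n^'n"
  assumes herm: "hermitian M"
  obtains U d where "unitary U" "M = U ** diag_mat d ** ctranspose U"
proof -
  obtain u :: "'n \<Rightarrow> complex^'n" and d :: "'n \<Rightarrow> real" where
    eig: "\<And>i. M *v u i = d i *\<^sub>R u i" and
    on: "\<And>i j. u i \<bullet> u j = (if i = j then 1 else 0) \<and> u i \<bullet> (\<i> *s u j) = 0"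
    using orthonormal_eigenvectors_exist[OF herm, of UNIV] by blast
  define U where "U = (\<chi> i j. u j $ i)"
  have "ctranspose U ** U = mat 1"
  proof -
    have "(ctranspose U ** U) $ i $ j = mat 1 $ i $ j" for i j
    proof (rule complex_eqI)
      show "Re ((ctranspose U ** U) $ i $ j) = Re (mat 1 $ i $ j)"
      proof -
        have "Re ((ctranspose U ** U) $ i $ j) = u i \<bullet> u j"
          by (simp add: U_def matrix_matrix_mult_def inner_vec_def inner_complex_def)
        then show ?thesis using on[of i j] by (simp add: mat_def)
      qed
      show "Im ((ctranspose U ** U) $ i $ j) = Im (mat 1 $ i $ j)"
      proof -
        have "Im ((ctranspose U ** U) $ i $ j) = - (u i \<bullet> (\<i> *s u j))"
          unfolding inner_vec_def sum_negf[symmetric]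
          by (simp add: U_def matrix_matrix_mult_def inner_complex_def)
        then show ?thesis using on[of i j] by (simp add: mat_def)
      qed
    qed
    then show ?thesis by (simp add: vec_eq_iff)
  qed
  then have U: "unitary U" "U ** ctranspose U = mat 1"
    using matrix_left_right_inverse[of "ctranspose U" U] by (auto simp: unitary_def)
  have "M ** U = U ** diag_mat d"
  proof -
    have "(M ** U) $ i $ j = (U ** diag_mat d) $ i $ j" for i j
    proof -
      have "(M ** U) $ i $ j = (M *v u j) $ i"
        by (simp add: U_def matrix_matrix_mult_def matrix_vector_mult_def)
      also have "\<dots> = (U ** diag_mat d) $ i $ j"
        unfolding eig by (simp add: U_def mult_diag_mat_nth scaleR_conv_of_real[of _ "u j $ i"])
      finally show ?thesis .
    qed
    then show ?thesis by (simp add: vec_eq_iff)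
  qed
  then have "M = U ** diag_mat d ** ctranspose U"
    using U(2) matrix_mul_assoc[of M U "ctranspose U"] by simp
  with U(1) that show ?thesis by blast
qed


lemma diag_mat_mult: "diag_mat a ** diag_mat b = diag_mat (\<lambda>i. a i * b i)"
  by (simp add: vec_eq_iff mult_diag_mat_nth) (simp add: diag_mat_def)

lemma diag_mat_mult_vector_nth: "(diag_mat d *v y) $ i = complex_of_real (d i) * y $ i"
proof -
  have "diag_mat d $ i $ j * y $ j = (if j = i then complex_of_real (d i) * y $ i else 0)" for j
    by (simp add: diag_mat_def)
  then show ?thesis by (simp add: matrix_vector_mult_def)
qed

lemma diag_mat_const: "diag_mat (\<lambda>_. c) = c *\<^sub>R mat 1"
  by (simp add: vec_eq_iff diag_mat_def mat_def of_real_def)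

lemma diag_mat_add: "diag_mat a + diag_mat b = diag_mat (\<lambda>i. a i + b i)"
  by (simp add: vec_eq_iff diag_mat_def)

lemma diag_mat_diff: "diag_mat a - diag_mat b = diag_mat (\<lambda>i. a i - b i)"
  by (simp add: vec_eq_iff diag_mat_def)

lemma hermitian_diag_mat: "hermitian (diag_mat d)"
  by (simp add: hermitian_def vec_eq_iff diag_mat_def)

lemma trace_diag_mat: "trace (diag_mat d) = complex_of_real (\<Sum>i\<in>UNIV. d i)"
  by (simp add: trace_def diag_mat_def)

lemma det_diag_mat: "det (diag_mat d) = complex_of_real (\<Prod>i\<in>UNIV. d i)"
  by (subst det_diagonal) (simp_all add: diag_mat_def)

lemma diag_mat_quadratic_form: "y \<bullet> (diag_mat d *v y) = (\<Sum>i\<in>UNIV. d i * (norm (y $ i))\<^sup>2)"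
  unfolding inner_vec_def
  by (intro sum.cong) (auto simp: diag_mat_mult_vector_nth inner_mult_left power2_norm_eq_inner
      scaleR_conv_of_real[symmetric])

lemma matrix_add_rdistrib:
  fixes A :: "complex^'n^'m"
  shows "(A + B) ** C = A ** C + B ** C"
  by (simp add: vec_eq_iff matrix_matrix_mult_def distrib_right sum.distrib)

lemma matrix_diff_ldistrib:
  fixes A :: "complex^'n^'m"
  shows "A ** (B - C) = A ** B - A ** C"
  by (metis add_diff_cancel_right' diff_add_cancel matrix_add_ldistrib)

lemma matrix_diff_rdistrib:
  fixes A :: "complex^'n^'m"
  shows "(A - B) ** C = A ** C - B ** C"
  by (metis add_diff_cancel_right' diff_add_cancel matrix_add_rdistrib)

lemma unitary_conj_mult:
  assumes "unitary U"
  shows "(U ** M ** ctranspose U) ** (U ** N ** ctranspose U) = U ** (M ** N) ** ctranspose U"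
proof -
  have "(U ** M ** ctranspose U) ** (U ** N ** ctranspose U)
      = U ** M ** (ctranspose U ** U) ** N ** ctranspose U"
    by (simp add: matrix_mul_assoc)
  also have "\<dots> = U ** (M ** N) ** ctranspose U"
    using assms by (simp add: unitary_def matrix_mul_assoc)
  finally show ?thesis .
qed

lemma unitary_conj_scaled_mat_1:
  assumes "unitary U"
  shows "U ** (c *\<^sub>R mat 1) ** ctranspose U = c *\<^sub>R mat 1"
  using assms by (simp add: unitary_def matrix_scalar_ac scalar_matrix_assoc[symmetric])

lemma trace_unitary_conj:
  assumes "unitary U"
  shows "trace (U ** M ** ctranspose U) = trace M"
proof -
  have "trace (U ** M ** ctranspose U) = trace (ctranspose U ** U ** M)"
    by (subst trace_mul_sym) (simp add: matrix_mul_assoc)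
  then show ?thesis using assms by (simp add: unitary_def)
qed

lemma det_unitary_conj:
  assumes "unitary U"
  shows "det (U ** M ** ctranspose U) = det M"
proof -
  have "det U * det (ctranspose U) = 1"
    using assms by (metis det_I det_mul unitary_def)
  then show ?thesis by (simp add: det_mul mult.commute mult.left_commute)
qed

lemma unitary_eq_0_iff: "unitary U \<Longrightarrow> U *v x = 0 \<longleftrightarrow> x = 0"
  by (metis matrix_vector_mul_assoc matrix_vector_mul_lid matrix_vector_mult_0_right unitary_def)

lemma unitary_ctranspose: "unitary U \<Longrightarrow> unitary (ctranspose U)"
  by (simp add: unitary_def)


section \<open>Definiteness and the spectral norm in terms of eigenvalues\<close>

lemma congruence_quadratic_form:
  "x \<bullet> ((ctranspose P ** M ** P) *v x) = (P *v x) \<bullet> (M *v (P *v x))"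
  using inner_ctranspose_mult_vector[of "ctranspose P" x "M *v (P *v x)"]
  by (simp add: matrix_vector_mul_assoc matrix_mul_assoc)

lemma pos_semidef_congruence: "pos_semidef M \<Longrightarrow> pos_semidef (ctranspose P ** M ** P)"
  by (simp add: pos_semidef_def hermitian_congruence congruence_quadratic_form)

lemma pos_def_congruence:
  assumes "pos_def M" "\<And>x. P *v x = 0 \<Longrightarrow> x = 0"
  shows "pos_def (ctranspose P ** M ** P)"
  using assms by (auto simp: pos_def_def hermitian_congruence congruence_quadratic_form)

lemma unitary_unconj:
  assumes "unitary U"
  shows "ctranspose U ** (U ** M ** ctranspose U) ** U = M"
proof -
  have "ctranspose U ** (U ** M ** ctranspose U) ** U = (ctranspose U ** U) ** M ** (ctranspose U ** U)"
    by (simp add: matrix_mul_assoc)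
  then show ?thesis using assms by (simp add: unitary_def)
qed

lemma pos_semidef_unitary_conj_iff:
  assumes U: "unitary U"
  shows "pos_semidef (U ** M ** ctranspose U) \<longleftrightarrow> pos_semidef M"
  using pos_semidef_congruence[of M "ctranspose U"]
    pos_semidef_congruence[of "U ** M ** ctranspose U" U] unitary_unconj[OF U, of M]
  by auto

lemma pos_def_unitary_conj_iff:
  assumes U: "unitary U"
  shows "pos_def (U ** M ** ctranspose U) \<longleftrightarrow> pos_def M"
  using pos_def_congruence[of M "ctranspose U"] pos_def_congruence[of "U ** M ** ctranspose U" U]
    unitary_unconj[OF U, of M] unitary_eq_0_iff[OF U] unitary_eq_0_iff[OF unitary_ctranspose[OF U]]
  by auto

lemma diag_mat_quadratic_form_axis: "axis i 1 \<bullet> (diag_mat d *v axis i 1) = d i"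
proof -
  have "d j * (norm (axis i (1::complex) $ j))\<^sup>2 = (if j = i then d i else 0)" for j
    by (simp add: axis_def)
  then show ?thesis by (simp add: diag_mat_quadratic_form)
qed

lemma pos_semidef_diag_mat_iff: "pos_semidef (diag_mat d) \<longleftrightarrow> (\<forall>i. 0 \<le> d i)"
proof
  assume "pos_semidef (diag_mat d)"
  then show "\<forall>i. 0 \<le> d i"
    by (metis diag_mat_quadratic_form_axis pos_semidef_def)
next
  assume "\<forall>i. 0 \<le> d i"
  then show "pos_semidef (diag_mat d)"
    by (simp add: pos_semidef_def hermitian_diag_mat diag_mat_quadratic_form sum_nonneg)
qed

lemma pos_def_diag_mat_iff: "pos_def (diag_mat d) \<longleftrightarrow> (\<forall>i. 0 < d i)"
proof
  assume "pos_def (diag_mat d)"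
  moreover have "axis i (1::complex) \<noteq> 0" for i by (simp add: axis_eq_0_iff)
  ultimately show "\<forall>i. 0 < d i"
    by (metis diag_mat_quadratic_form_axis pos_def_def)
next
  assume d: "\<forall>i. 0 < d i"
  have "0 < (\<Sum>i\<in>UNIV. d i * (norm (x $ i))\<^sup>2)" if nz: "x \<noteq> 0" for x :: "complex^'a"
  proof -
    obtain i where "x $ i \<noteq> 0" using nz by (auto simp: vec_eq_iff)
    then show ?thesis
      using d by (intro sum_pos2[of _ i]) (auto simp: less_imp_le)
  qed
  then show "pos_def (diag_mat d)"
    by (simp add: pos_def_def hermitian_diag_mat diag_mat_quadratic_form)
qed

text \<open>
  \<open>Y\<^sup>* Y = U D\<^sup>2 U\<^sup>*\<close>, so \<open>s\<^sup>2\<close> is an eigenvalue of \<open>Y\<^sup>* Y\<close> precisely if it is a diagonal entry of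
  \<open>D\<^sup>2\<close>.
\<close>

lemma singular_values_hermitian:
  assumes U: "unitary U" and Y: "Y = U ** diag_mat d ** ctranspose U"
  shows "singular_values Y = range (\<lambda>i. \<bar>d i\<bar>)"
proof -
  have "hermitian Y"
    unfolding Y using hermitian_congruence[OF hermitian_diag_mat, of "ctranspose U" d] by simp
  then have YY: "ctranspose Y ** Y = U ** diag_mat (\<lambda>i. (d i)\<^sup>2) ** ctranspose U"
    by (simp add: hermitian_def) (simp add: Y unitary_conj_mult[OF U] diag_mat_mult power2_eq_square)
  have eig: "(ctranspose Y ** Y) *v v = c *s v \<longleftrightarrow>
      diag_mat (\<lambda>i. (d i)\<^sup>2) *v (ctranspose U *v v) = c *s (ctranspose U *v v)" for v c
  proof -
    let ?D = "diag_mat (\<lambda>i. (d i)\<^sup>2)"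
    have UU: "ctranspose U *v (U *v x) = x" "U *v (ctranspose U *v x) = x" for x
      using U by (simp_all add: unitary_def matrix_vector_mul_assoc)
    have "(ctranspose Y ** Y) *v v = U *v (?D *v (ctranspose U *v v))"
      unfolding YY by (simp add: matrix_vector_mul_assoc matrix_mul_assoc)
    moreover have "c *s v = U *v (c *s (ctranspose U *v v))"
      by (simp add: vector_scalar_commute UU)
    ultimately show ?thesis by (metis UU(1))
  qed
  show ?thesis
  proof (intro set_eqI iffI)
    fix s
    assume "s \<in> singular_values Y"
    then obtain v where s: "0 \<le> s" and "v \<noteq> 0"
      and "(ctranspose Y ** Y) *v v = complex_of_real (s\<^sup>2) *s v"
      by (auto simp: singular_values_def)
    moreover define w where "w = ctranspose U *v v"
    ultimately have "w \<noteq> 0" and w: "diag_mat (\<lambda>i. (d i)\<^sup>2) *v w = complex_of_real (s\<^sup>2) *s w"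
      using unitary_eq_0_iff[OF unitary_ctranspose[OF U]] eig by auto
    then obtain i where i: "w $ i \<noteq> 0" by (auto simp: vec_eq_iff)
    have "complex_of_real ((d i)\<^sup>2) * w $ i = complex_of_real (s\<^sup>2) * w $ i"
      using arg_cong[OF w, of "\<lambda>x. x $ i"] by (simp add: diag_mat_mult_vector_nth)
    then have "(d i)\<^sup>2 = s\<^sup>2" using i by (metis mult_right_cancel of_real_eq_iff)
    then have "s = \<bar>d i\<bar>" using s by (metis real_sqrt_abs abs_of_nonneg)
    then show "s \<in> range (\<lambda>i. \<bar>d i\<bar>)" by blast
  next
    fix s
    assume "s \<in> range (\<lambda>i. \<bar>d i\<bar>)"
    then obtain i where s: "s = \<bar>d i\<bar>" by blast
    define v where "v = U *v axis i 1"
    have "v \<noteq> 0" by (simp add: v_def unitary_eq_0_iff[OF U] axis_eq_0_iff)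
    moreover have "ctranspose U *v v = axis i 1"
      using U by (simp add: v_def unitary_def matrix_vector_mul_assoc)
    then have "(ctranspose Y ** Y) *v v = complex_of_real (s\<^sup>2) *s v"
      by (simp add: eig) (simp add: vec_eq_iff diag_mat_mult_vector_nth axis_def s flip: of_real_power)
    moreover have "0 \<le> s" by (simp add: s)
    ultimately show "s \<in> singular_values Y"
      unfolding singular_values_def by blast
  qed
qed

text \<open>
  In an eigenbasis of \<open>Y\<close> the matrices \<open>c I + Y\<close> and \<open>c I - Y\<close> are diagonal with entries
  \<open>c + d i\<close> and \<open>c - d i\<close>; both are nonnegative for all \<open>i\<close> iff \<open>\<bar>d i\<bar> \<le> c\<close> for all \<open>i\<close>.
\<close>

lemma spectral_norm_le_iff_pos_semidef:
  fixes Y :: "complex^'n^'n"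
  assumes "hermitian Y"
  shows "spectral_norm Y \<le> c \<longleftrightarrow>
    pos_semidef (c *\<^sub>R mat 1 + Y) \<and> pos_semidef (c *\<^sub>R mat 1 - Y)"
proof -
  obtain U d where U: "unitary U" and Y: "Y = U ** diag_mat d ** ctranspose U"
    using hermitian_unitarily_diagonalizable[OF assms] by blast
  have "c *\<^sub>R mat 1 + Y = U ** diag_mat (\<lambda>i. c + d i) ** ctranspose U"
    unfolding diag_mat_add[symmetric] diag_mat_const matrix_add_ldistrib matrix_add_rdistrib
      unitary_conj_scaled_mat_1[OF U] Y ..
  then have plus: "pos_semidef (c *\<^sub>R mat 1 + Y) \<longleftrightarrow> (\<forall>i. 0 \<le> c + d i)"
    by (simp add: pos_semidef_unitary_conj_iff[OF U] pos_semidef_diag_mat_iff)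
  have "c *\<^sub>R mat 1 - Y = U ** diag_mat (\<lambda>i. c - d i) ** ctranspose U"
    unfolding diag_mat_diff[symmetric] diag_mat_const matrix_diff_ldistrib matrix_diff_rdistrib
      unitary_conj_scaled_mat_1[OF U] Y ..
  then have minus: "pos_semidef (c *\<^sub>R mat 1 - Y) \<longleftrightarrow> (\<forall>i. 0 \<le> c - d i)"
    by (simp add: pos_semidef_unitary_conj_iff[OF U] pos_semidef_diag_mat_iff)
  have "spectral_norm Y \<le> c \<longleftrightarrow> (\<forall>i. \<bar>d i\<bar> \<le> c)"
    by (simp add: spectral_norm_def singular_values_hermitian[OF U Y])
  also have "\<dots> \<longleftrightarrow> (\<forall>i. 0 \<le> c + d i) \<and> (\<forall>i. 0 \<le> c - d i)"
  proof -
    have "\<bar>x\<bar> \<le> c \<longleftrightarrow> 0 \<le> c + x \<and> 0 \<le> c - x" for x :: real by linarith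
    then show ?thesis by blast
  qed
  finally show ?thesis using plus minus by simp
qed


section \<open>The conjugate of the negative log-determinant\<close>

lemma pos_def_det:
  assumes "pos_def M"
  shows "0 < Re (det M)" "Im (det M) = 0"
proof -
  obtain U d where U: "unitary U" and M: "M = U ** diag_mat d ** ctranspose U"
    using hermitian_unitarily_diagonalizable assms pos_def_def by metis
  have "\<forall>i. 0 < d i"
    using assms by (simp add: M pos_def_unitary_conj_iff[OF U] pos_def_diag_mat_iff)
  then have "0 < (\<Prod>i\<in>UNIV. d i)" by (simp add: prod_pos)
  moreover have "det M = complex_of_real (\<Prod>i\<in>UNIV. d i)"
    unfolding M det_unitary_conj[OF U] by (rule det_diag_mat)
  ultimately show "0 < Re (det M)" "Im (det M) = 0" by (simp_all del: of_real_prod)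
qed

text \<open>
  The factor is \<open>U\<close> times the diagonal matrix of the square roots of the eigenvalues. It turns
  \<open>M X\<close>, which need not be Hermitian, into \<open>Q\<^sup>* X Q\<close>, which is positive definite and has the same
  trace and determinant.
\<close>

lemma pos_def_factorization:
  fixes M :: "complex^'n^'n"
  assumes "pos_def M"
  obtains Q :: "complex^'n^'n" where "M = Q ** ctranspose Q" "\<And>x. Q *v x = 0 \<Longrightarrow> x = 0"
proof -
  obtain U d where U: "unitary U" and M: "M = U ** diag_mat d ** ctranspose U"
    using hermitian_unitarily_diagonalizable assms pos_def_def by metis
  have d: "0 < d i" for i
    using assms by (simp add: M pos_def_unitary_conj_iff[OF U] pos_def_diag_mat_iff)
  define R where "R = diag_mat (\<lambda>i. sqrt (d i))"
  have R: "ctranspose R = R" "R ** R = diag_mat d"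
    using d hermitian_diag_mat by (auto simp: R_def diag_mat_mult less_imp_le hermitian_def)
  have "M = (U ** R) ** ctranspose (U ** R)"
    unfolding ctranspose_mult M R(2)[symmetric] R(1) by (simp add: matrix_mul_assoc)
  moreover have "x = 0" if "(U ** R) *v x = 0" for x
  proof -
    have "R *v x = 0"
      using that unitary_eq_0_iff[OF U] by (simp flip: matrix_vector_mul_assoc)
    then have "complex_of_real (sqrt (d i)) * x $ i = 0" for i
      unfolding R_def by (metis diag_mat_mult_vector_nth zero_index)
    then show ?thesis using d by (simp add: vec_eq_iff less_imp_neq[THEN not_sym])
  qed
  ultimately show ?thesis using that by blast
qed

text \<open>
  This is \<open>ln e \<le> e - 1\<close> summed over the eigenvalues.
\<close>

lemma ln_det_le_trace:
  fixes N :: "complex^'n^'n"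
  assumes "pos_def N"
  shows "ln (Re (det N)) \<le> Re (trace N) - real CARD('n)"
proof -
  obtain V e where V: "unitary V" and N: "N = V ** diag_mat e ** ctranspose V"
    using hermitian_unitarily_diagonalizable assms pos_def_def by metis
  have e: "0 < e i" for i
    using assms by (simp add: N pos_def_unitary_conj_iff[OF V] pos_def_diag_mat_iff)
  have "ln (Re (det N)) = ln (\<Prod>i\<in>UNIV. e i)"
    unfolding N det_unitary_conj[OF V] det_diag_mat by (simp del: of_real_prod)
  also have "\<dots> = (\<Sum>i\<in>UNIV. ln (e i))" using e by (simp add: ln_prod less_imp_neq[THEN not_sym])
  also have "\<dots> \<le> (\<Sum>i\<in>UNIV. e i - 1)" by (intro sum_mono ln_le_minus_one e)
  also have "\<dots> = Re (trace N) - real CARD('n)"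
    unfolding N trace_unitary_conj[OF V] trace_diag_mat by (simp add: sum_subtractf del: of_real_sum)
  finally show ?thesis .
qed

lemma ln_det_add_ln_det_le_trace:
  fixes M X :: "complex^'n^'n"
  assumes M: "pos_def M" and X: "pos_def X"
  shows "ln (Re (det M)) + ln (Re (det X)) \<le> Re (trace (M ** X)) - real CARD('n)"
proof -
  obtain Q :: "complex^'n^'n" where Q: "M = Q ** ctranspose Q" "\<And>x. Q *v x = 0 \<Longrightarrow> x = 0"
    using pos_def_factorization[OF M] by metis
  define N where "N = ctranspose Q ** X ** Q"
  have "pos_def N" unfolding N_def using pos_def_congruence X Q(2) by blast
  have tr: "trace N = trace (M ** X)"
    unfolding N_def Q(1) by (subst trace_mul_sym) (simp add: matrix_mul_assoc)
  have "det N = det M * det X"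
    by (simp add: N_def Q(1) det_mul)
  then have "Re (det N) = Re (det M) * Re (det X)"
    using pos_def_det(2)[OF M] by simp
  then have "ln (Re (det N)) = ln (Re (det M)) + ln (Re (det X))"
    using pos_def_det(1)[OF M] pos_def_det(1)[OF X] by (simp add: ln_mult)
  then show ?thesis using ln_det_le_trace[OF \<open>pos_def N\<close>] tr by simp
qed

text \<open>
  The inverse of \<open>M\<close> attains the bound of \<open>ln_det_add_ln_det_le_trace\<close>.
\<close>

lemma ln_det_add_ln_det_eq_trace:
  fixes M :: "complex^'n^'n"
  assumes "pos_def M"
  obtains X where "pos_def X" "ln (Re (det M)) + ln (Re (det X)) = Re (trace (M ** X)) - real CARD('n)"
proof -
  obtain U d where U: "unitary U" and M: "M = U ** diag_mat d ** ctranspose U"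
    using hermitian_unitarily_diagonalizable assms pos_def_def by metis
  have d: "0 < d i" for i
    using assms by (simp add: M pos_def_unitary_conj_iff[OF U] pos_def_diag_mat_iff)
  define X where "X = U ** diag_mat (\<lambda>i. 1 / d i) ** ctranspose U"
  have X: "pos_def X"
    using d by (simp add: X_def pos_def_unitary_conj_iff[OF U] pos_def_diag_mat_iff)
  have "d i * (1 / d i) = 1" for i using d[of i] by simp
  then have MX: "M ** X = mat 1"
    using U by (simp add: M X_def unitary_conj_mult[OF U] diag_mat_mult diag_mat_const unitary_def)
  then have "det M * det X = 1" by (metis det_I det_mul)
  moreover have "Re (det M * det X) = Re (det M) * Re (det X)"
    using pos_def_det(2)[OF assms] by simp
  ultimately have "Re (det M) * Re (det X) = 1" by simp
  then have "ln (Re (det M)) + ln (Re (det X)) = 0"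
    using pos_def_det(1)[OF assms] pos_def_det(1)[OF X] by (metis ln_mult ln_one less_numeral_extra(3))
  then show ?thesis using that[OF X] by (simp add: MX trace_I)
qed

text \<open>
  Let \<open>X\<close> share the eigenbasis of \<open>M\<close>, with eigenvalue \<open>exp s\<close> at an index where \<open>M\<close> has an
  eigenvalue \<open>\<le> 0\<close> and \<open>1\<close> elsewhere. Then \<open>ln det X = s\<close>, while \<open>trace (M X)\<close> is at most the
  sum of the remaining eigenvalues of \<open>M\<close>, whatever \<open>s\<close> is.
\<close>

lemma not_pos_def_imp_unbounded:
  fixes M :: "complex^'n^'n"
  assumes herm: "hermitian M" and "\<not> pos_def M"
  obtains X where "pos_def X" "- ln (Re (det X)) + Re (trace (M ** X)) \<le> B"
proof -
  obtain U d where U: "unitary U" and M: "M = U ** diag_mat d ** ctranspose U"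
    using hermitian_unitarily_diagonalizable[OF herm] by blast
  obtain k where k: "d k \<le> 0"
    using assms(2) by (auto simp: M pos_def_unitary_conj_iff[OF U] pos_def_diag_mat_iff not_less)
  \<comment> \<open>The value of \<open>ln det X\<close> that offsets the rest of the trace and leaves \<open>B\<close>.\<close>
  define s where "s = (\<Sum>i\<in>UNIV - {k}. d i) - B"
  define e where "e = (\<lambda>i. if i = k then exp s else 1)"
  define X where "X = U ** diag_mat e ** ctranspose U"
  have "pos_def X"
    by (simp add: X_def e_def pos_def_unitary_conj_iff[OF U] pos_def_diag_mat_iff)
  moreover have "Re (det X) = exp s"
    unfolding X_def det_unitary_conj[OF U] det_diag_mat by (simp add: e_def del: of_real_prod)
  moreover have "Re (trace (M ** X)) = (\<Sum>i\<in>UNIV. d i * e i)"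
    unfolding M X_def unitary_conj_mult[OF U] trace_unitary_conj[OF U] diag_mat_mult trace_diag_mat
    by (simp del: of_real_sum)
  moreover have "(\<Sum>i\<in>UNIV. d i * e i) = d k * exp s + (\<Sum>i\<in>UNIV - {k}. d i)"
    by (subst sum.remove[of _ k]) (auto simp: e_def)
  moreover have "d k * exp s \<le> 0"
    using k by (simp add: mult_nonpos_nonneg)
  ultimately show ?thesis using that[of X] by (simp add: s_def)
qed

text \<open>
  For \<open>c = 0\<close> this is minus the convex conjugate of \<open>- log det\<close> at \<open>- M\<close>. The constant \<open>c\<close> is carried along because
  the dual function needs the infimum of a shifted function, and pulling a constant out of an
  infimum in the extended reals would require side conditions.
\<close>

lemma Inf_neg_log_det_plus_linear:
  fixes M :: "complex^'n^'n"
  assumes herm: "hermitian M"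
  shows "(INF X\<in>{X. hermitian X}. - log_det X + ereal (Re (trace (M ** X)) + c)) =
    log_det M + ereal (real CARD('n) + c)" (is "?I = _")
proof (cases "pos_def M")
  case True
  obtain X0 where X0: "pos_def X0"
      "ln (Re (det M)) + ln (Re (det X0)) = Re (trace (M ** X0)) - real CARD('n)"
    using ln_det_add_ln_det_eq_trace[OF True] by blast
  have "?I \<le> - log_det X0 + ereal (Re (trace (M ** X0)) + c)"
    using X0(1) by (intro INF_lower) (simp add: pos_def_def)
  also have "\<dots> = log_det M + ereal (real CARD('n) + c)"
    using True X0 by (simp add: log_det_def)
  finally have "?I \<le> log_det M + ereal (real CARD('n) + c)" .
  moreover have "log_det M + ereal (real CARD('n) + c) \<le> ?I"
  proof (intro INF_greatest)
    fix X :: "complex^'n^'n"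
    show "log_det M + ereal (real CARD('n) + c) \<le> - log_det X + ereal (Re (trace (M ** X)) + c)"
      using True ln_det_add_ln_det_le_trace[OF True, of X]
      by (cases "pos_def X") (simp_all add: log_det_def)
  qed
  ultimately show ?thesis by (rule antisym)
next
  case False
  have "?I \<le> ereal B" for B
  proof -
    obtain X where X: "pos_def X" "- ln (Re (det X)) + Re (trace (M ** X)) \<le> B - c"
      using not_pos_def_imp_unbounded[OF herm False] by blast
    have "?I \<le> - log_det X + ereal (Re (trace (M ** X)) + c)"
      using X(1) by (intro INF_lower) (simp add: pos_def_def)
    also have "\<dots> \<le> ereal B" using X by (simp add: log_det_def)
    finally show ?thesis .
  qed
  then have "?I = - \<infinity>" by (rule ereal_bot)
  then show ?thesis using False by (simp add: log_det_def)
qed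


section \<open>The dual function\<close>

lemma mat_inner_eq_sum: "mat_inner M N = (\<Sum>i\<in>UNIV. \<Sum>j\<in>UNIV. cnj (M $ j $ i) * N $ j $ i)"
  by (simp add: mat_inner_def trace_def matrix_matrix_mult_def)

lemma mat_inner_self_pos:
  assumes "P \<noteq> 0"
  shows "0 < Re (mat_inner P P)"
proof -
  have eq: "Re (mat_inner P P) = (\<Sum>i\<in>UNIV. \<Sum>j\<in>UNIV. (norm (P $ j $ i))\<^sup>2)"
  proof -
    have "Re (cnj z * z) = (norm z)\<^sup>2" for z
      by (simp add: cmod_power2 flip: power2_eq_square)
    then show ?thesis by (simp only: mat_inner_eq_sum Re_sum)
  qed
  obtain a b where ab: "P $ a $ b \<noteq> 0" using assms by (auto simp: vec_eq_iff)
  have "0 < (\<Sum>j\<in>UNIV. (norm (P $ j $ b))\<^sup>2)"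
    using ab by (intro sum_pos2[of _ a]) auto
  then show ?thesis
    unfolding eq by (rule sum_pos2[of UNIV b, rotated 2]) (auto intro: sum_nonneg)
qed

lemma mat_inner_A1:
  assumes "hermitian Y"
  shows "mat_inner Y (A1 A X) = trace (A1_adj A Y ** X)"
proof -
  have "trace (Y ** X ** ctranspose A) = trace (ctranspose A ** Y ** X)"
    by (subst trace_mul_sym) (simp add: matrix_mul_assoc)
  then show ?thesis
    using assms by (simp add: mat_inner_def A1_def A1_adj_def hermitian_def matrix_add_ldistrib
        matrix_add_rdistrib trace_add matrix_mul_assoc)
qed

lemma hermitian_hadamard: "hermitian M \<Longrightarrow> hermitian N \<Longrightarrow> hermitian (hadamard M N)"
  by (simp add: hermitian_def hadamard_def vec_eq_iff)

text \<open>
  Entrywise multiplication by the real matrix \<open>E\<close> is self-adjoint for the trace inner product.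
\<close>

lemma mat_inner_A2:
  assumes Y: "hermitian Y" and E: "hermitian E" "\<And>i j. cnj (E $ i $ j) = E $ i $ j"
  shows "mat_inner Y (A2 C E X) = trace (A2_adj C E Y ** X)"
proof -
  have "mat_inner Y (A2 C E X) = mat_inner (hadamard E Y) (C ** X ** ctranspose C)"
    by (simp add: mat_inner_eq_sum A2_def hadamard_def E(2) mult_ac)
  also have "\<dots> = trace (hadamard E Y ** C ** X ** ctranspose C)"
    using hermitian_hadamard[OF E(1) Y] by (simp add: mat_inner_def hermitian_def matrix_mul_assoc)
  also have "\<dots> = trace (A2_adj C E Y ** X)"
    by (subst trace_mul_sym) (simp add: A2_adj_def matrix_mul_assoc)
  finally show ?thesis .
qed

lemma hermitian_A1_adj: "hermitian Y \<Longrightarrow> hermitian (A1_adj A Y)"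
  by (simp add: hermitian_def A1_adj_def ctranspose_add ctranspose_mult add.commute)

lemma hermitian_A2_adj: "hermitian E \<Longrightarrow> hermitian Y \<Longrightarrow> hermitian (A2_adj C E Y)"
  unfolding A2_adj_def by (intro hermitian_congruence hermitian_hadamard)

text \<open>
  Each summand involves at most one primal variable, so the infimum over the three variables splits.
\<close>

lemma lagrangian_collected:
  assumes Y1: "hermitian Y1" and Y2: "hermitian Y2" and G: "hermitian G"
    and E: "hermitian E" "\<And>i j. cnj (E $ i $ j) = E $ i $ j"
    and L: "hermitian Lp" "hermitian Lm"
  shows "lagrangian A C E G \<gamma> X Zp Zm Y1 Y2 Lp Lm = - log_det X + ereal
      (Re (trace ((A1_adj A Y1 + A2_adj C E Y2) ** X))
       + (Re (mat_inner (\<gamma> *\<^sub>R mat 1 + Y1 - Lp) Zp) + Re (mat_inner (\<gamma> *\<^sub>R mat 1 - Y1 - Lm) Zm)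
          - Re (mat_inner G Y2)))"
proof -
  have *: "mat_inner (M + N) Z = mat_inner M Z + mat_inner N Z"
    "mat_inner (M - N) Z = mat_inner M Z - mat_inner N Z"
    "mat_inner Z (M + N) = mat_inner Z M + mat_inner Z N"
    "mat_inner Z (M - N) = mat_inner Z M - mat_inner Z N" for M N Z :: "complex^'x^'x"
    by (simp_all add: mat_inner_def ctranspose_add ctranspose_diff matrix_add_ldistrib matrix_add_rdistrib
        matrix_diff_ldistrib matrix_diff_rdistrib trace_add trace_sub)
  have "mat_inner (\<gamma> *\<^sub>R mat 1) Z = \<gamma> *\<^sub>R trace Z" for Z :: "complex^'a^'a"
    by (simp add: mat_inner_def ctranspose_scaleR trace_def scaleR_sum_right flip: scalar_matrix_assoc)
  moreover have "mat_inner Y2 G = mat_inner G Y2"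
    using Y2 G trace_mul_sym[of Y2 G] by (simp add: mat_inner_def hermitian_def)
  ultimately show ?thesis
    unfolding lagrangian_def primal_objective_def residual1_def residual2_def
    by (simp add: * mat_inner_A1[OF Y1] mat_inner_A2[OF Y2 E] matrix_add_rdistrib trace_add
        add.assoc algebra_simps)
qed


lemma Inf_over_ineffective_variables:
  fixes f :: "'a \<Rightarrow> 'b::complete_lattice"
  assumes "T \<noteq> {}"
  shows "(INF (x, y) \<in> S \<times> T. f x) = (INF x\<in>S. f x)"
proof -
  have "(\<lambda>(x, y). f x) ` (S \<times> T) = f ` S" using assms by force
  then show ?thesis by simp
qed

text \<open>
  Vanishing coefficients of \<open>Zp\<close> and \<open>Zm\<close> leave the infimum over \<open>X\<close>. Otherwise the coefficients
  \<open>P\<close> and \<open>Q\<close>, being Hermitian, are themselves admissible directions: along \<open>Zp = - t P\<close>,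
  \<open>Zm = - t Q\<close> the Lagrangian at \<open>X = I\<close> is affine in \<open>t\<close> with slope \<open>- (\<parallel>P\<parallel>\<^sup>2 + \<parallel>Q\<parallel>\<^sup>2) < 0\<close> in the
  Frobenius norm.
\<close>

lemma dual_function_eq:
  fixes A :: "complex^'n^'n" and C :: "complex^'n^'p"
  assumes Y1: "hermitian Y1" and Y2: "hermitian Y2" and G: "hermitian G"
    and E: "hermitian E" "\<And>i j. cnj (E $ i $ j) = E $ i $ j"
    and L: "hermitian Lp" "hermitian Lm"
  shows "dual_function A C E G \<gamma> Y1 Y2 Lp Lm =
    (if Lp = \<gamma> *\<^sub>R mat 1 + Y1 \<and> Lm = \<gamma> *\<^sub>R mat 1 - Y1 then dual_objective A C E G Y1 Y2 else - \<infinity>)"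
    (is "?D = _")
proof -
  define P where "P = \<gamma> *\<^sub>R mat 1 + Y1 - Lp"
  define Q where "Q = \<gamma> *\<^sub>R mat 1 - Y1 - Lm"
  define M where "M = A1_adj A Y1 + A2_adj C E Y2"
  let ?H = "{Z::complex^'n^'n. hermitian Z}"
  have herm: "hermitian P" "hermitian Q" "hermitian M"
    unfolding P_def Q_def M_def
    by (intro hermitian_add hermitian_diff hermitian_scaleR hermitian_mat_1 hermitian_A1_adj
        hermitian_A2_adj E Y1 Y2 L)+
  have lag: "lagrangian A C E G \<gamma> X Zp Zm Y1 Y2 Lp Lm = - log_det X + ereal (Re (trace (M ** X))
      + (Re (mat_inner P Zp) + Re (mat_inner Q Zm) - Re (mat_inner G Y2)))" for X Zp Zm
    unfolding M_def P_def Q_def by (rule lagrangian_collected[OF assms])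
  show ?thesis
  proof (cases "P = 0 \<and> Q = 0")
    case True
    have "mat_inner 0 Z = 0" for Z :: "complex^'n^'n" by (simp add: mat_inner_eq_sum)
    then have "?D = (INF (X, Z) \<in> ?H \<times> ?H \<times> ?H. - log_det X + ereal (Re (trace (M ** X)) + - Re (mat_inner G Y2)))"
      unfolding dual_function_def lag using True by (simp add: case_prod_unfold)
    also have "\<dots> = (INF X \<in> ?H. - log_det X + ereal (Re (trace (M ** X)) + - Re (mat_inner G Y2)))"
      using hermitian_mat_1 by (intro Inf_over_ineffective_variables) blast
    also have "\<dots> = log_det M + ereal (real CARD('n) + - Re (mat_inner G Y2))"
      by (rule Inf_neg_log_det_plus_linear[OF herm(3)])
    also have "\<dots> = dual_objective A C E G Y1 Y2"
      unfolding dual_objective_def M_def[symmetric] by (cases "log_det M") simp_all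
    finally show ?thesis using True by (simp add: P_def Q_def)
  next
    case False
    define s where "s = Re (mat_inner P P) + Re (mat_inner Q Q)"
    have nonneg: "0 \<le> Re (mat_inner Z Z)" for Z :: "complex^'n^'n"
      using mat_inner_self_pos[of Z] by (cases "Z = 0") (auto simp: mat_inner_eq_sum)
    have "0 < s"
      using False mat_inner_self_pos[of P] mat_inner_self_pos[of Q] nonneg[of P] nonneg[of Q]
      by (auto simp: s_def intro: add_pos_nonneg add_nonneg_pos)
    have I: "pos_def (mat 1 :: complex^'n^'n)"
      using pos_def_diag_mat_iff[of "\<lambda>_::'n. 1"] by (simp add: diag_mat_const)
    have "?D \<le> ereal B" for B
    proof -
      \<comment> \<open>The parameter at which the affine function of \<open>t\<close> takes the value \<open>B\<close>.\<close>
      define t where "t = (Re (trace M) - Re (mat_inner G Y2) - B) / s"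
      have scale: "mat_inner Z (r *\<^sub>R Z) = r *\<^sub>R mat_inner Z Z" for r and Z :: "complex^'n^'n"
        by (simp add: mat_inner_eq_sum scaleR_sum_right)
      have "?D \<le> lagrangian A C E G \<gamma> (mat 1) ((- t) *\<^sub>R P) ((- t) *\<^sub>R Q) Y1 Y2 Lp Lm"
        unfolding dual_function_def
        by (rule INF_lower2[of "(mat 1, (- t) *\<^sub>R P, (- t) *\<^sub>R Q)"])
          (auto simp only: mem_Times_iff mem_Collect_eq fst_conv snd_conv prod.case
            intro: hermitian_mat_1 hermitian_scaleR herm)
      also have "\<dots> = ereal (Re (trace M) - t * s - Re (mat_inner G Y2))"
        unfolding lag scale by (simp add: log_det_def I s_def algebra_simps)
      also have "\<dots> = ereal B" using \<open>0 < s\<close> by (simp add: t_def)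
      finally show ?thesis .
    qed
    then have "?D = - \<infinity>" by (rule ereal_bot)
    then show ?thesis using False by (auto simp: P_def Q_def)
  qed
qed

lemma Sup_of_single_nontrivial_value:
  fixes c :: "'b::complete_lattice"
  shows "(SUP x\<in>S. if x = a then c else bot) = (if a \<in> S then c else bot)"
  by (auto intro!: antisym SUP_least SUP_upper2[of a])

text \<open>
  The dual function is \<open>-\<infinity>\<close> except at one pair of multipliers, and \<open>-\<infinity>\<close> is the least extended
  real. Hence the supremum over the multipliers is the value at that pair if both its components are
  positive semidefinite, and \<open>-\<infinity>\<close> if not.
\<close>

theorem lagrange_dual_eq:
  fixes A :: "complex^'n^'n" and C :: "complex^'n^'p"
  assumes Y1: "hermitian Y1" and Y2: "hermitian Y2" and G: "hermitian G"
    and E: "hermitian E" "\<And>i j. cnj (E $ i $ j) = E $ i $ j"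
  shows "lagrange_dual A C E G \<gamma> Y1 Y2 =
    (if spectral_norm Y1 \<le> \<gamma> then dual_objective A C E G Y1 Y2 else - \<infinity>)"
proof -
  let ?a = "(\<gamma> *\<^sub>R mat 1 + Y1, \<gamma> *\<^sub>R mat 1 - Y1)"
  let ?S = "{L::complex^'n^'n. pos_semidef L} \<times> {L::complex^'n^'n. pos_semidef L}"
  have "lagrange_dual A C E G \<gamma> Y1 Y2 = (SUP x\<in>?S. if x = ?a then dual_objective A C E G Y1 Y2 else bot)"
    unfolding lagrange_dual_def
    by (intro SUP_cong refl) (auto simp: dual_function_eq[OF assms] pos_semidef_def bot_ereal_def split: if_splits)
  also have "\<dots> = (if ?a \<in> ?S then dual_objective A C E G Y1 Y2 else bot)"
    by (rule Sup_of_single_nontrivial_value)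
  also have "?a \<in> ?S \<longleftrightarrow> spectral_norm Y1 \<le> \<gamma>"
    using spectral_norm_le_iff_pos_semidef[OF Y1] by simp
  finally show ?thesis by (simp add: bot_ereal_def)
qed

theorem proposition4:
  fixes A :: "complex^'n^'n"
    and C :: "complex^'n^'p"
    and G E :: "complex^'p^'p"
    and \<gamma> :: real
  assumes "hurwitz A"
    and "hermitian G"
    and "\<forall>i j. E $ i $ j \<in> {0, 1}"
    and "transpose E = E"
    and "\<forall>i j. E $ i $ j = 0 \<longrightarrow> G $ i $ j = 0"
    and "\<gamma> > 0"
  shows "(\<forall>Y1 Y2. hermitian Y1 \<and> hermitian Y2 \<longrightarrow>
           lagrange_dual A C E G \<gamma> Y1 Y2 =
             (if spectral_norm Y1 \<le> \<gamma> then dual_objective A C E G Y1 Y2 else - \<infinity>))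
       \<and>
         (SUP (Y1, Y2, Lp, Lm) \<in> {Y. hermitian Y} \<times> {Y. hermitian Y}
                              \<times> {L. pos_semidef L} \<times> {L. pos_semidef L}.
            dual_function A C E G \<gamma> Y1 Y2 Lp Lm) =
         (SUP (Y1, Y2) \<in> {(Y1, Y2). hermitian Y1 \<and> hermitian Y2 \<and> spectral_norm Y1 \<le> \<gamma>}.
            dual_objective A C E G Y1 Y2)"
    (is "?pointwise \<and> ?lhs = ?rhs")
proof
  have E1: "cnj (E $ i $ j) = E $ i $ j" for i j
    using assms(3)[rule_format, of i j] by auto
  have "transpose E $ i $ j = E $ j $ i" for i j by (simp add: transpose_def)
  then have "cnj (E $ j $ i) = E $ i $ j" for i j by (simp add: E1 assms(4))
  then have E2: "hermitian E" by (simp add: hermitian_def vec_eq_iff)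
  show pointwise: ?pointwise
    using lagrange_dual_eq[OF _ _ assms(2) E2 E1] by blast
  show "?lhs = ?rhs"
  proof (rule antisym)
    show "?lhs \<le> ?rhs"
    proof (intro SUP_least, clarify)
      fix Y1 Lp Lm :: "complex^'n^'n" and Y2 :: "complex^'p^'p"
      assume Y: "hermitian Y1" "hermitian Y2" and L: "pos_semidef Lp" "pos_semidef Lm"
      have "dual_function A C E G \<gamma> Y1 Y2 Lp Lm \<le> lagrange_dual A C E G \<gamma> Y1 Y2"
        unfolding lagrange_dual_def using L by (intro SUP_upper2[of "(Lp, Lm)"]) auto
      also have "\<dots> = (if spectral_norm Y1 \<le> \<gamma> then dual_objective A C E G Y1 Y2 else - \<infinity>)"
        using pointwise Y by blast
      also have "\<dots> \<le> ?rhs"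
      proof (cases "spectral_norm Y1 \<le> \<gamma>")
        case True
        have "dual_objective A C E G Y1 Y2 \<le> ?rhs"
          by (rule SUP_upper2[of "(Y1, Y2)"]) (simp_all add: Y True)
        with True show ?thesis by simp
      qed simp
      finally show "dual_function A C E G \<gamma> Y1 Y2 Lp Lm \<le> ?rhs" .
    qed
    show "?rhs \<le> ?lhs"
    proof (intro SUP_least, clarify)
      fix Y1 :: "complex^'n^'n" and Y2 :: "complex^'p^'p"
      assume Y: "hermitian Y1" "hermitian Y2" and le: "spectral_norm Y1 \<le> \<gamma>"
      have "dual_objective A C E G Y1 Y2 = lagrange_dual A C E G \<gamma> Y1 Y2"
        using pointwise Y le by simp
      also have "\<dots> \<le> ?lhs"
        unfolding lagrange_dual_def
      proof (intro SUP_least, clarify)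
        fix Lp Lm :: "complex^'n^'n"
        assume "pos_semidef Lp" "pos_semidef Lm"
        then show "dual_function A C E G \<gamma> Y1 Y2 Lp Lm \<le> ?lhs"
          using Y by (intro SUP_upper2[of "(Y1, Y2, Lp, Lm)"]) auto
      qed
      finally show "dual_objective A C E G Y1 Y2 \<le> ?lhs" .
    qed
  qed
qed

end
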